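(* Let $H \in (0,1)$, $K \in (0,1)$ and $T \in (0,\infty)$, and let $Z_{H,K}$ be a trifractional Brownian motion with parameters $H$ and $K$. For $\alpha \in \mathbb{R}$ and $n \in \mathbb{N}$ put $$S_n^{\alpha} := 2^{\alpha n} \sum_{k = 1}^{2^n}\left(Z_{H,K}\Big(\frac{kT}{2^n}\Big) - Z_{H,K}\Big(\frac{(k-1)T}{2^n}\Big)\right)^2 .$$ Then the following hold. (1) If $HK < \frac12$, then almost surely $\lim_{n\to\infty} S_n^\alpha = 0$ for every $\alpha < 2HK$, and almost surely $\lim_{n\to\infty} S_n^\alpha = \infty$ for every $\alpha > 2HK$. In particular, the critical exponent of the weighted quadratic variation of $Z_{H,K}$ is $\gamma = 2HK$. (2) If $HK \ge \frac12$, then almost surely $\lim_{n\to\infty} S_n^\alpha = 0$ for every $\alpha < 1$, and almost surely $\lim_{n\to\infty} S_n^\alpha = \infty$ for every $\alpha > 1$. In particular, the critical exponent of the weighted quadratic variation of $Z_{H,K}$ is $\gamma = 1$.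
   Context: A trifractional Brownian motion $Z_{H,K} = \{Z_{H,K}(t), t\in[0,\infty)\}$ with parameters $H\in(0,1)$ and $K\in(0,1)$ is a centered Gaussian process with covariance function $$C_{H,K}(s,t) = t^{2HK} + s^{2HK} - (t^{2H}+s^{2H})^{K}, \qquad s,t\in[0,\infty).$$ For a real-valued process $X=\{X(t),t\in[0,\infty)\}$, a number $\gamma\in\mathbb{R}$ is called the critical exponent of the weighted quadratic variation of $X$ if, almost surely, $\lim_{n\to\infty}2^{\alpha n}\sum_{k=1}^{2^n}\big(X(\frac{k}{2^n})-X(\frac{k-1}{2^n})\big)^2$ equals $0$ for $\alpha<\gamma$ and equals $\infty$ for $\alpha>\gamma$. *)

theory Defs
  imports "HOL-Probability.Probability"
begin

text \<open>Almost surely constant random variables count as (degenerate) Gaussian random variables.\<close>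

definition gaussian_rv :: "'a measure \<Rightarrow> ('a \<Rightarrow> real) \<Rightarrow> bool" where
  "gaussian_rv M Y \<longleftrightarrow>
     Y \<in> borel_measurable M \<and>
     ((\<exists>\<mu> \<sigma>. \<sigma> > 0 \<and> distributed M lborel Y (normal_density \<mu> \<sigma>)) \<or>
      (\<exists>\<mu>. AE \<omega> in M. Y \<omega> = \<mu>))"

text \<open>Gaussianity of all finite-dimensional distributions, expressed as Gaussianity of all finite
  linear combinations.\<close>

definition gaussian_process :: "'a measure \<Rightarrow> real set \<Rightarrow> (real \<Rightarrow> 'a \<Rightarrow> real) \<Rightarrow> bool" where
  "gaussian_process M I X \<longleftrightarrow>
     (\<forall>J c. finite J \<and> J \<subseteq> I \<longrightarrow> gaussian_rv M (\<lambda>\<omega>. \<Sum>t\<in>J. c t * X t \<omega>))"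

definition covariance :: "'a measure \<Rightarrow> ('a \<Rightarrow> real) \<Rightarrow> ('a \<Rightarrow> real) \<Rightarrow> real" where
  "covariance M Y Z =
     (LINT \<omega>|M. (Y \<omega> - (LINT \<omega>'|M. Y \<omega>')) * (Z \<omega> - (LINT \<omega>'|M. Z \<omega>')))"

definition trifractional_covariance :: "real \<Rightarrow> real \<Rightarrow> real \<Rightarrow> real \<Rightarrow> real" where
  "trifractional_covariance H K s t =
     t powr (2 * H * K) + s powr (2 * H * K) - (t powr (2 * H) + s powr (2 * H)) powr K"

text \<open>Only the values of the process at times in \<open>{0..}\<close> are constrained; as the exponents are
  positive, the convention \<open>0 powr a = 0\<close> gives the right covariance at time 0.\<close>

definition trifractional_Brownian_motion ::
    "'a measure \<Rightarrow> real \<Rightarrow> real \<Rightarrow> (real \<Rightarrow> 'a \<Rightarrow> real) \<Rightarrow> bool" where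
  "trifractional_Brownian_motion M H K Z \<longleftrightarrow>
     prob_space M \<and> 0 < H \<and> H < 1 \<and> 0 < K \<and> K < 1 \<and>
     gaussian_process M {0..} Z \<and>
     (\<forall>t\<ge>0. (LINT \<omega>|M. Z t \<omega>) = 0) \<and>
     (\<forall>s\<ge>0. \<forall>t\<ge>0. covariance M (Z s) (Z t) = trifractional_covariance H K s t)"

definition weighted_quadratic_variation ::
    "(real \<Rightarrow> 'a \<Rightarrow> real) \<Rightarrow> real \<Rightarrow> real \<Rightarrow> nat \<Rightarrow> 'a \<Rightarrow> real" where
  "weighted_quadratic_variation X T \<alpha> n \<omega> =
     2 powr (\<alpha> * real n) *
       (\<Sum>k = 1..2 ^ n. (X (real k * T / 2 ^ n) \<omega> - X ((real k - 1) * T / 2 ^ n) \<omega>)\<^sup>2)"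

text \<open>The critical exponent refers to the dyadic partitions of the unit interval.\<close>

definition critical_exponent :: "'a measure \<Rightarrow> (real \<Rightarrow> 'a \<Rightarrow> real) \<Rightarrow> real \<Rightarrow> bool" where
  "critical_exponent M X \<gamma> \<longleftrightarrow>
     (AE \<omega> in M.
        (\<forall>\<alpha><\<gamma>. (\<lambda>n. weighted_quadratic_variation X 1 \<alpha> n \<omega>) \<longlonglongrightarrow> 0) \<and>
        (\<forall>\<alpha>>\<gamma>. filterlim (\<lambda>n. weighted_quadratic_variation X 1 \<alpha> n \<omega>) at_top sequentially))"

end

theory Submission
  imports Defs
begin

text \<open>
  The increment of \<open>Z\<close> over the \<open>k\<close>-th interval of a partition of mesh \<open>d\<close> has variance at most
  \<open>16 d\<^bsup>2HK\<^esup> k\<^bsup>2HK-2\<^esup>\<close>. With \<open>\<gamma> = min (2 H K) 1\<close>, summing over \<open>k \<le> 2\<^sup>n\<close> gives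
  \<open>E S\<^sub>n \<le> C 2\<^bsup>(\<alpha> - \<gamma> + \<epsilon>) n\<^esup>\<close>, which is summable when \<open>\<alpha> < \<gamma>\<close> and \<open>\<epsilon>\<close> is small, so \<open>S\<^sub>n\<close> tends to 0 almost
  surely. For the divergence it suffices to bound \<open>S\<^sub>n\<close> from below, at \<open>\<alpha> = \<gamma>\<close>, by the square of one
  centred Gaussian variable of variance independent of \<open>n\<close>: the rescaled first increment if
  \<open>2 H K < 1\<close>, and \<open>Z T - Z 0\<close> (by Cauchy-Schwarz) otherwise. A Gaussian variable is rarely small, so
  Borel-Cantelli shows that this square eventually exceeds \<open>2\<^bsup>-\<delta> n\<^esup>\<close> for every \<open>\<delta> > 0\<close>.
\<close>

section \<open>Elementary bounds for the increment variances and their sums\<close>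

text \<open>The left side is \<open>2 powr (K + 1)\<close> times the midpoint Jensen gap of the
  concave map \<open>x powr K\<close>, hence of second order in \<open>a - b\<close>. This square
  later produces the decay \<open>k powr (-2)\<close>.\<close>

lemma powr_mean_gap:
  fixes a b K :: real
  assumes "0 \<le> b" "b \<le> a" "0 < a" "0 < K" "K \<le> 1"
  shows "2 * (a + b) powr K - 2 powr K * (a powr K + b powr K) \<le> 4 * a powr K * ((a - b) / a)\<^sup>2"
proof -
  \<comment> \<open>This makes \<open>1 - w\<close> the squared ratio of the geometric to the
    arithmetic mean of \<open>a\<close> and \<open>b\<close>.\<close>
  define w where "w = ((a - b) / (a + b))\<^sup>2"
  have w01: "0 \<le> w" "w \<le> 1"
    using assms by (auto simp: w_def power_le_one_iff)
  \<comment> \<open>AM-GM bounds \<open>2 powr K * (a powr K + b powr K)\<close> below by \<open>2 * (4 * a * b) powr (K / 2)\<close>,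
    and \<open>(1 - w) powr (K / 2) \<ge> 1 - w\<close> because \<open>K / 2 \<le> 1\<close>.\<close>
  have prod: "4 * (a * b) = (a + b)\<^sup>2 * (1 - w)"
  proof -
    have "(a + b)\<^sup>2 * w = (a - b)\<^sup>2"
      using assms by (simp add: w_def power_divide)
    then show ?thesis by (simp add: power2_eq_square algebra_simps)
  qed
  have "(a + b) powr K * (1 - w) \<le> (a + b) powr K * (1 - w) powr (K / 2)"
    using powr_mono'[of "K / 2" 1 "1 - w"] w01 assms by (intro mult_left_mono) auto
  also have "\<dots> = ((a + b)\<^sup>2 * (1 - w)) powr (K / 2)"
    using assms w01 by (simp add: powr_mult powr_powr flip: powr_numeral)
  also have "\<dots> = (2 powr 2 * (a * b)) powr (K / 2)"
    by (simp flip: prod)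
  also have "\<dots> = 2 powr K * (a * b) powr (K / 2)"
    using assms by (simp add: powr_mult powr_powr del: powr_numeral)
  also have "(a * b) powr (K / 2) = sqrt (a powr K * b powr K)"
    using assms by (simp add: powr_mult powr_powr flip: powr_half_sqrt)
  also have "2 powr K * sqrt (a powr K * b powr K) \<le> 2 powr K * ((a powr K + b powr K) / 2)"
    by (intro mult_left_mono arith_geo_mean_sqrt) auto
  finally have "2 * (a + b) powr K - 2 powr K * (a powr K + b powr K) \<le> 2 * ((a + b) powr K * w)"
    by (simp add: algebra_simps)
  also have "(a + b) powr K * w \<le> (2 * a powr K) * ((a - b) / a)\<^sup>2"
  proof (rule mult_mono)
    have "(a + b) powr K \<le> (2 * a) powr K"
      using assms by (intro powr_mono2) auto
    also have "\<dots> \<le> 2 * a powr K"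
      using assms powr_mono[of K 1 2] by (simp add: powr_mult)
    finally show "(a + b) powr K \<le> 2 * a powr K" .
    show "w \<le> ((a - b) / a)\<^sup>2"
      unfolding w_def using assms by (intro power_mono divide_left_mono) auto
  qed (use w01 in auto)
  finally show ?thesis by simp
qed

text \<open>This is \<open>C(t,t) + C(s,s) - 2 C(s,t)\<close> for the trifractional covariance
  \<open>C\<close>, using \<open>C(t,t) = (2 - 2 powr K) * t powr (2 * H * K)\<close>.\<close>

definition increment_variance :: "real \<Rightarrow> real \<Rightarrow> real \<Rightarrow> real \<Rightarrow> real" where
  "increment_variance H K s t =
     2 * (t powr (2 * H) + s powr (2 * H)) powr K -
     2 powr K * (t powr (2 * H * K) + s powr (2 * H * K))"

text \<open>With \<open>t = k d\<close> the bound reads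
  \<open>16 d^2 t powr (2 * H * K - 2)\<close>: away from the origin the variance is quadratic in
  the mesh, and the roughness sits at time 0. The constant is \<open>4 * 2^2\<close>, from
  \<open>powr_mean_gap\<close> and a relative gap of at most \<open>2 / k\<close>.\<close>

lemma increment_variance_le:
  fixes H K d :: real and k :: nat
  assumes "0 < H" "H < 1" "0 < K" "K < 1" "0 < d" "1 \<le> k"
  shows "increment_variance H K ((real k - 1) * d) (real k * d)
           \<le> 16 * d powr (2 * H * K) * real k powr (2 * H * K - 2)"
proof -
  define q where "q = (real k - 1) / real k"
  define a where "a = (real k * d) powr (2 * H)"
  define b where "b = ((real k - 1) * d) powr (2 * H)"
  have q: "0 \<le> q" "q \<le> 1" and q': "1 - q = 1 / real k"
    using assms by (auto simp: q_def field_simps)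
  have a: "0 < a" using assms by (auto simp: a_def)
  have "(real k - 1) * d = q * (real k * d)"
    using assms by (simp add: q_def)
  then have b: "b = a * q powr (2 * H)"
    using assms q unfolding a_def b_def by (simp add: powr_mult)
  have "q powr (2 * H) \<le> 1"
    using q assms powr_mono2[of "2 * H" q 1] by auto
  \<comment> \<open>Raising the exponent \<open>2 * H\<close> to 2 lowers the power of
    \<open>q\<close> in [0,1] and leaves a gap \<open>1 - q^2\<close> that factors.\<close>
  have "q\<^sup>2 \<le> q powr (2 * H)"
    using powr_mono'[of "2 * H" 2 q] q assms by simp
  then have "(a - b) / a \<le> 1 - q\<^sup>2"
    using a by (simp add: b field_simps)
  also have "\<dots> = (1 - q) * (1 + q)" by (simp add: power2_eq_square algebra_simps)
  also have "\<dots> \<le> 2 / real k"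
    using q mult_left_mono[of "1 + q" 2 "1 - q"] by (simp add: q')
  finally have ab: "(a - b) / a \<le> 2 / real k" .
  have b': "0 \<le> b" "b \<le> a"
    using a \<open>q powr (2 * H) \<le> 1\<close> by (auto simp: b mult_le_cancel_left1)
  have "increment_variance H K ((real k - 1) * d) (real k * d) =
      2 * (a + b) powr K - 2 powr K * (a powr K + b powr K)"
    by (simp add: increment_variance_def a_def b_def powr_powr)
  also have "\<dots> \<le> 4 * a powr K * ((a - b) / a)\<^sup>2"
    using assms a b' by (intro powr_mean_gap) auto
  also have "\<dots> \<le> 4 * a powr K * (2 / real k)\<^sup>2"
    using ab a b' by (intro mult_left_mono power_mono) auto
  also have "a powr K = d powr (2 * H * K) * real k powr (2 * H * K)"
    using assms by (simp add: a_def powr_powr powr_mult)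
  also have "4 * (d powr (2 * H * K) * real k powr (2 * H * K)) * (2 / real k)\<^sup>2
      = 16 * d powr (2 * H * K) * real k powr (2 * H * K - 2)"
    using assms by (simp add: powr_diff field_simps)
  finally show ?thesis .
qed

text \<open>Split \<open>k powr (p - 2)\<close> into \<open>k powr (p - g + e)\<close>, which is at
  most its value at \<open>N\<close>, and \<open>k powr (g - 2 - e)\<close>, whose exponent is below
  -1. The loss \<open>e\<close> also absorbs the logarithm of the harmonic case
  \<open>p = g = 1\<close>.\<close>

lemma sum_powr_le:
  fixes p g e :: real
  assumes "g \<le> 1" "g \<le> p" "0 < e"
  shows "\<exists>C\<ge>0. \<forall>N. (\<Sum>k = 1..N. real k powr (p - 2)) \<le> C * real N powr (p - g + e)"
proof -
  have sm: "summable (\<lambda>k. real k powr (g - 2 - e))"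
    using assms by (simp add: summable_real_powr_iff)
  show ?thesis
  proof (intro exI conjI allI)
    show "0 \<le> (\<Sum>k. real k powr (g - 2 - e))"
      by (intro suminf_nonneg sm) auto
    fix N :: nat
    have "(\<Sum>k = 1..N. real k powr (p - 2)) =
        (\<Sum>k = 1..N. real k powr (p - g + e) * real k powr (g - 2 - e))"
      by (intro sum.cong) (auto simp flip: powr_add)
    also have "\<dots> \<le> (\<Sum>k = 1..N. real N powr (p - g + e) * real k powr (g - 2 - e))"
      using assms by (intro sum_mono mult_right_mono powr_mono2) auto
    also have "\<dots> = real N powr (p - g + e) * (\<Sum>k = 1..N. real k powr (g - 2 - e))"
      by (simp add: sum_distrib_left)
    also have "\<dots> \<le> real N powr (p - g + e) * (\<Sum>k. real k powr (g - 2 - e))"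
      by (intro mult_left_mono sum_le_suminf sm) auto
    finally show "(\<Sum>k = 1..N. real k powr (p - 2)) \<le> (\<Sum>k. real k powr (g - 2 - e)) * real N powr (p - g + e)"
      by (simp add: mult.commute)
  qed
qed

section \<open>Moments and small-ball estimates for Gaussian variables and increments\<close>

text \<open>Since the integral of a non-integrable function is 0 by default, the covariance identity
  alone does not give finite second moments; Gaussianity does.\<close>

lemma gaussian_rv_square_integrable:
  assumes "prob_space M" "gaussian_rv M Y"
  shows "integrable M (\<lambda>\<omega>. (Y \<omega>)\<^sup>2)"
proof -
  interpret prob_space M by fact
  have Y [measurable]: "Y \<in> borel_measurable M"
    using assms by (simp add: gaussian_rv_def)
  from assms(2) consider \<mu> \<sigma> where "\<sigma> > 0" "distributed M lborel Y (normal_density \<mu> \<sigma>)"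
    | \<mu> where "AE \<omega> in M. Y \<omega> = \<mu>"
    by (auto simp: gaussian_rv_def)
  then show ?thesis
  proof cases
    case 1
    \<comment> \<open>\<open>integrable_normal_moment\<close> concerns central moments, so
      \<open>x^2\<close> is expanded about \<mu>.\<close>
    have "integrable lborel (\<lambda>x. normal_density \<mu> \<sigma> x * (x - \<mu>) ^ 2
        + 2 * \<mu> * (normal_density \<mu> \<sigma> x * (x - \<mu>) ^ 1) + \<mu>\<^sup>2 * (normal_density \<mu> \<sigma> x * (x - \<mu>) ^ 0))"
      using integrable_normal_moment[OF 1(1), of \<mu>] by (intro Bochner_Integration.integrable_add integrable_mult_right) blast+
    also have "(\<lambda>x. normal_density \<mu> \<sigma> x * (x - \<mu>) ^ 2
        + 2 * \<mu> * (normal_density \<mu> \<sigma> x * (x - \<mu>) ^ 1) + \<mu>\<^sup>2 * (normal_density \<mu> \<sigma> x * (x - \<mu>) ^ 0))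
        = (\<lambda>x. normal_density \<mu> \<sigma> x * x\<^sup>2)"
      by (simp add: fun_eq_iff power2_eq_square algebra_simps)
    finally show ?thesis
      using distributed_integrable[OF 1(2), of "\<lambda>x. x\<^sup>2"] by simp
  next
    case 2
    then have "AE \<omega> in M. \<mu>\<^sup>2 = (Y \<omega>)\<^sup>2" by auto
    then show ?thesis
      using integrable_cong_AE_imp[of M "\<lambda>_. \<mu>\<^sup>2" "\<lambda>\<omega>. (Y \<omega>)\<^sup>2"] by simp
  qed
qed

text \<open>The density is at most \<open>1 / sqrt (2 * pi * v)\<close>, hence at most
  \<open>1 / sqrt v\<close>, and the interval has length \<open>2 * r\<close>.\<close>

lemma gaussian_small_ball:
  assumes "prob_space M" "gaussian_rv M Y"
    and mean: "(LINT \<omega>|M. Y \<omega>) = 0" and var: "(LINT \<omega>|M. (Y \<omega>)\<^sup>2) = v" "0 < v" and "0 \<le> r"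
  shows "measure M {\<omega> \<in> space M. \<bar>Y \<omega>\<bar> < r} \<le> 2 * r / sqrt v"
proof -
  interpret prob_space M by fact
  have Y [measurable]: "Y \<in> borel_measurable M"
    using assms by (simp add: gaussian_rv_def)
  from assms(2) consider \<mu> \<sigma> where "\<sigma> > 0" "distributed M lborel Y (normal_density \<mu> \<sigma>)"
    | \<mu> where "AE \<omega> in M. Y \<omega> = \<mu>"
    by (auto simp: gaussian_rv_def)
  then show ?thesis
  proof cases
    case 1
    have "\<sigma>\<^sup>2 = v"
      using normal_distributed_variance[OF 1] mean var by simp
    then have \<sigma>: "sqrt v = \<sigma>" using 1 by auto
    have "emeasure M {\<omega> \<in> space M. \<bar>Y \<omega>\<bar> < r} = emeasure M (Y -` {-r<..<r} \<inter> space M)"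
      by (intro arg_cong[where f = "emeasure M"]) auto
    also have "\<dots> = (\<integral>\<^sup>+x. ennreal (normal_density \<mu> \<sigma> x) * indicator {-r<..<r} x \<partial>lborel)"
      using distributed_emeasure[OF 1(2)] by simp
    also have "\<dots> \<le> (\<integral>\<^sup>+x. ennreal (1 / \<sigma>) * indicator {-r<..<r} x \<partial>lborel)"
    proof (intro nn_integral_mono mult_right_mono ennreal_leI)
      fix x
      have "normal_density \<mu> \<sigma> x \<le> 1 / sqrt (2 * pi * \<sigma>\<^sup>2) * 1"
        unfolding normal_density_def by (intro mult_left_mono) auto
      also have "\<dots> \<le> 1 / \<sigma>"
      proof -
        have "\<sigma> = sqrt (1 * \<sigma>\<^sup>2)" using 1 by simp
        also have "\<dots> \<le> sqrt (2 * pi * \<sigma>\<^sup>2)"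
          using pi_gt3 by (intro real_sqrt_le_mono mult_right_mono) auto
        finally show ?thesis using 1 by (simp add: frac_le)
      qed
      finally show "normal_density \<mu> \<sigma> x \<le> 1 / \<sigma>" .
    qed auto
    also have "\<dots> = ennreal (2 * r / \<sigma>)"
      using 1 \<open>0 \<le> r\<close> by (simp add: nn_integral_cmult_indicator flip: ennreal_mult)
    finally show ?thesis
      using 1 \<open>0 \<le> r\<close> by (simp add: \<sigma> emeasure_eq_measure)
  next
    \<comment> \<open>A constant of mean 0 is 0 and has second moment 0, contradicting
      \<open>0 < v\<close>.\<close>
    case 2
    then have "(LINT \<omega>|M. Y \<omega>) = (LINT \<omega>|M. \<mu>)" and "(LINT \<omega>|M. (Y \<omega>)\<^sup>2) = (LINT \<omega>|M. \<mu>\<^sup>2)"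
      by (intro integral_cong_AE; auto)+
    then show ?thesis using mean var by (simp add: prob_space)
  qed
qed

lemma trifractional_Brownian_motion_increment:
  assumes Z: "trifractional_Brownian_motion M H K Z" and st: "0 \<le> s" "0 \<le> t" "s \<noteq> t"
  shows "gaussian_rv M (\<lambda>\<omega>. c * (Z t \<omega> - Z s \<omega>))"
    and "(LINT \<omega>|M. Z t \<omega> - Z s \<omega>) = 0"
    and "integrable M (\<lambda>\<omega>. (Z t \<omega> - Z s \<omega>)\<^sup>2)"
    and "(LINT \<omega>|M. (Z t \<omega> - Z s \<omega>)\<^sup>2) = increment_variance H K s t"
proof -
  interpret prob_space M using Z by (simp add: trifractional_Brownian_motion_def)
  have comb: "gaussian_rv M (\<lambda>\<omega>. \<Sum>u\<in>J. c u * Z u \<omega>)" if "finite J" "J \<subseteq> {0..}" for J c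
    using Z that by (auto simp: trifractional_Brownian_motion_def gaussian_process_def)
  \<comment> \<open>As \<open>s \<noteq> t\<close>, the sum over the set \<open>{s, t}\<close> has
    two terms and the coefficients can be chosen separately.\<close>
  have incr: "gaussian_rv M (\<lambda>\<omega>. c * (Z t \<omega> - Z s \<omega>))" for c
    using comb[of "{s, t}" "\<lambda>u. if u = t then c else - c"] st by (simp add: algebra_simps)
  show "gaussian_rv M (\<lambda>\<omega>. c * (Z t \<omega> - Z s \<omega>))" by (rule incr)
  have gauss: "gaussian_rv M (Z u)" if "0 \<le> u" for u
    using comb[of "{u}" "\<lambda>_. 1"] that by simp
  have meas [measurable]: "Z u \<in> borel_measurable M" if "0 \<le> u" for u
    using gauss[OF that] by (simp add: gaussian_rv_def)
  have sq: "integrable M (\<lambda>\<omega>. (Z u \<omega>)\<^sup>2)" if "0 \<le> u" for u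
    using gaussian_rv_square_integrable[OF prob_space_axioms gauss[OF that]] .
  have int: "integrable M (Z u)" if "0 \<le> u" for u
    using square_integrable_imp_integrable[OF meas sq] that by blast
  have mean: "(LINT \<omega>|M. Z u \<omega>) = 0" if "0 \<le> u" for u
    using Z that by (simp add: trifractional_Brownian_motion_def)
  have cov: "(LINT \<omega>|M. Z u \<omega> * Z v \<omega>) = trifractional_covariance H K u v"
    if "0 \<le> u" "0 \<le> v" for u v
  proof -
    have "covariance M (Z u) (Z v) = trifractional_covariance H K u v"
      using Z that by (simp add: trifractional_Brownian_motion_def)
    then show ?thesis by (simp add: covariance_def mean that)
  qed
  show "(LINT \<omega>|M. Z t \<omega> - Z s \<omega>) = 0"
    using int mean st by simp
  show sqd: "integrable M (\<lambda>\<omega>. (Z t \<omega> - Z s \<omega>)\<^sup>2)"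
    using gaussian_rv_square_integrable[OF prob_space_axioms incr[of 1]] by simp
  \<comment> \<open>Polarization: the product is a combination of three integrable squares.\<close>
  have "integrable M (\<lambda>\<omega>. (1 / 2) * ((Z t \<omega>)\<^sup>2 + (Z s \<omega>)\<^sup>2 - (Z t \<omega> - Z s \<omega>)\<^sup>2))"
    using sqd sq st by simp
  also have "(\<lambda>\<omega>. (1 / 2) * ((Z t \<omega>)\<^sup>2 + (Z s \<omega>)\<^sup>2 - (Z t \<omega> - Z s \<omega>)\<^sup>2)) = (\<lambda>\<omega>. Z s \<omega> * Z t \<omega>)"
    by (simp add: fun_eq_iff power2_eq_square algebra_simps)
  finally have prod: "integrable M (\<lambda>\<omega>. Z s \<omega> * Z t \<omega>)" .
  have "(LINT \<omega>|M. (Z t \<omega> - Z s \<omega>)\<^sup>2) =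
      (LINT \<omega>|M. (Z t \<omega>)\<^sup>2 + (Z s \<omega>)\<^sup>2 - 2 * (Z s \<omega> * Z t \<omega>))"
    by (simp add: power2_eq_square algebra_simps)
  also have "\<dots> = (LINT \<omega>|M. (Z t \<omega>)\<^sup>2) + (LINT \<omega>|M. (Z s \<omega>)\<^sup>2) - 2 * (LINT \<omega>|M. Z s \<omega> * Z t \<omega>)"
    using sq st prod by simp
  also have "\<dots> = increment_variance H K s t"
    using st by (simp add: power2_eq_square cov trifractional_covariance_def increment_variance_def)
      (simp add: powr_mult powr_powr algebra_simps flip: mult_2)
  finally show "(LINT \<omega>|M. (Z t \<omega> - Z s \<omega>)\<^sup>2) = increment_variance H K s t" .
qed

section \<open>Criteria for almost sure convergence and divergence\<close>

text \<open>By monotone convergence the random series has finite expectation, so it converges almost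
  surely and its terms vanish in the limit.\<close>

lemma AE_tendsto_zero_if_summable_integral:
  fixes f :: "nat \<Rightarrow> 'a \<Rightarrow> real"
  assumes int: "\<And>n. integrable M (f n)" and nonneg: "\<And>n \<omega>. 0 \<le> f n \<omega>"
    and summ: "summable (\<lambda>n. LINT \<omega>|M. f n \<omega>)"
  shows "AE \<omega> in M. (\<lambda>n. f n \<omega>) \<longlonglongrightarrow> 0"
proof -
  have [measurable]: "f n \<in> borel_measurable M" for n using int by auto
  have "(\<integral>\<^sup>+\<omega>. (\<Sum>n. ennreal (f n \<omega>)) \<partial>M) = (\<Sum>n. \<integral>\<^sup>+\<omega>. ennreal (f n \<omega>) \<partial>M)"
    by (intro nn_integral_suminf) auto
  also have "\<dots> = (\<Sum>n. ennreal (LINT \<omega>|M. f n \<omega>))"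
    using int nonneg by (simp add: nn_integral_eq_integral)
  also have "\<dots> = ennreal (\<Sum>n. LINT \<omega>|M. f n \<omega>)"
    using nonneg summ by (intro suminf_ennreal2) auto
  finally have "(\<integral>\<^sup>+\<omega>. (\<Sum>n. ennreal (f n \<omega>)) \<partial>M) \<noteq> \<infinity>" by simp
  then have "AE \<omega> in M. (\<Sum>n. ennreal (f n \<omega>)) \<noteq> \<infinity>"
    by (intro nn_integral_PInf_AE) auto
  then show ?thesis
    by eventually_elim (auto intro!: summable_LIMSEQ_zero summable_suminf_not_top nonneg)
qed

lemma summable_two_powr_neg: "0 < \<delta> \<Longrightarrow> summable (\<lambda>n. 2 powr (- \<delta> * real n) :: real)"
proof -
  assume "0 < \<delta>"
  then have "summable (\<lambda>n. (2 powr - \<delta> :: real) ^ n)"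
    by (intro summable_geometric) (simp add: powr_less_one)
  then show ?thesis by (simp add: powr_powr flip: powr_realpow)
qed

text \<open>Only the law of each single \<open>W n\<close> enters: the small-ball probabilities are
  summable, so the first Borel-Cantelli lemma applies whatever the dependence between the
  \<open>W n\<close>.\<close>

lemma AE_filterlim_at_top_if_ge_gaussian_square:
  fixes W S :: "nat \<Rightarrow> 'a \<Rightarrow> real"
  assumes "prob_space M" and gauss: "\<And>n. gaussian_rv M (W n)"
    and mean: "\<And>n. (LINT \<omega>|M. W n \<omega>) = 0"
    and var: "\<And>n. (LINT \<omega>|M. (W n \<omega>)\<^sup>2) = v" and "0 < v"
    and ge: "\<And>n \<omega>. (W n \<omega>)\<^sup>2 \<le> S n \<omega>" and "0 < \<delta>"
  shows "AE \<omega> in M. filterlim (\<lambda>n. 2 powr (\<delta> * real n) * S n \<omega>) at_top sequentially"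
proof -
  interpret prob_space M by fact
  have [measurable]: "W n \<in> borel_measurable M" for n
    using gauss by (simp add: gaussian_rv_def)
  \<comment> \<open>With \<open>\<delta> / 4\<close> here, \<open>r n ^ 2\<close> consumes half of
    the weight \<open>2 powr (\<delta> * n)\<close>, and the rest still diverges.\<close>
  define r :: "nat \<Rightarrow> real" where "r n = 2 powr (- (\<delta> / 4) * real n)" for n
  define A where "A n = {\<omega> \<in> space M. \<bar>W n \<omega>\<bar> < r n}" for n
  have "summable (\<lambda>n. measure M (A n))"
  proof (rule summable_comparison_test')
    show "summable (\<lambda>n. 2 * r n / sqrt v)"
      unfolding r_def using \<open>0 < \<delta>\<close> by (intro summable_divide summable_mult summable_two_powr_neg) auto
    show "norm (measure M (A n)) \<le> 2 * r n / sqrt v" if "n \<ge> 0" for n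
      using gaussian_small_ball[OF prob_space_axioms gauss mean var \<open>0 < v\<close>, of "r n" n] by (simp add: A_def r_def)
  qed
  then have "AE \<omega> in M. eventually (\<lambda>n. \<omega> \<in> space M - A n) sequentially"
    by (intro borel_cantelli_AE1) (auto simp: A_def emeasure_eq_measure)
  then show ?thesis
  proof eventually_elim
    case (elim \<omega>)
    have "filterlim (\<lambda>n. (2 powr (\<delta> / 2)) ^ n :: real) at_top sequentially"
      using \<open>0 < \<delta>\<close> filterlim_realpow_sequentially_gt1[of "2 powr (\<delta> / 2) :: real"]
      by (intro filterlim_at_infinity_imp_filterlim_at_top) auto
    then show ?case
    proof (rule filterlim_at_top_mono)
      show "eventually (\<lambda>n. (2 powr (\<delta> / 2)) ^ n \<le> 2 powr (\<delta> * real n) * S n \<omega>) sequentially"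
        using elim
      proof eventually_elim
        case (elim n)
        have "r n ^ 2 \<le> \<bar>W n \<omega>\<bar> ^ 2"
          using elim by (intro power_mono) (auto simp: A_def r_def)
        also have "\<dots> \<le> S n \<omega>" using ge by simp
        finally have "2 powr (\<delta> * real n) * r n ^ 2 \<le> 2 powr (\<delta> * real n) * S n \<omega>"
          by (intro mult_left_mono) auto
        also have "2 powr (\<delta> * real n) * r n ^ 2 = (2 powr (\<delta> / 2)) ^ n"
          by (simp add: r_def power2_eq_square powr_powr flip: powr_add powr_realpow)
        finally show ?case .
      qed
    qed
  qed
qed

text \<open>There are uncountably many \<delta>, but both weights are monotone in \<delta>, so the
  countably many values \<open>1 / (j + 1)\<close> suffice and their null sets can be
  united.\<close>

lemma AE_all_exponents:
  fixes Q :: "nat \<Rightarrow> 'a \<Rightarrow> real"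
  assumes nonneg: "\<And>n \<omega>. 0 \<le> Q n \<omega>"
    and zero: "\<And>\<delta>. 0 < \<delta> \<Longrightarrow> AE \<omega> in M. (\<lambda>n. 2 powr (- \<delta> * real n) * Q n \<omega>) \<longlonglongrightarrow> 0"
    and top: "\<And>\<delta>. 0 < \<delta> \<Longrightarrow>
      AE \<omega> in M. filterlim (\<lambda>n. 2 powr (\<delta> * real n) * Q n \<omega>) at_top sequentially"
  shows "AE \<omega> in M. (\<forall>\<delta>>0. (\<lambda>n. 2 powr (- \<delta> * real n) * Q n \<omega>) \<longlonglongrightarrow> 0) \<and>
    (\<forall>\<delta>>0. filterlim (\<lambda>n. 2 powr (\<delta> * real n) * Q n \<omega>) at_top sequentially)"
proof -
  let ?e = "\<lambda>j. inverse (real (Suc j))"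
  have "AE \<omega> in M. \<forall>j. (\<lambda>n. 2 powr (- ?e j * real n) * Q n \<omega>) \<longlonglongrightarrow> 0"
    unfolding AE_all_countable by (intro allI zero) auto
  moreover have "AE \<omega> in M. \<forall>j. filterlim (\<lambda>n. 2 powr (?e j * real n) * Q n \<omega>) at_top sequentially"
    unfolding AE_all_countable by (intro allI top) auto
  ultimately show ?thesis
  proof eventually_elim
    case (elim \<omega>)
    show ?case
    proof (intro conjI allI impI)
      fix \<delta> :: real assume "0 < \<delta>"
      then obtain j where j: "?e j < \<delta>" using reals_Archimedean by blast
      show "(\<lambda>n. 2 powr (- \<delta> * real n) * Q n \<omega>) \<longlonglongrightarrow> 0"
      proof (rule tendsto_sandwich[OF _ _ tendsto_const])
        show "\<forall>\<^sub>F n in sequentially. 0 \<le> 2 powr (- \<delta> * real n) * Q n \<omega>"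
          using nonneg by simp
        show "\<forall>\<^sub>F n in sequentially. 2 powr (- \<delta> * real n) * Q n \<omega> \<le> 2 powr (- ?e j * real n) * Q n \<omega>"
          using j by (intro always_eventually allI mult_right_mono nonneg powr_mono) auto
      qed (use elim in blast)
      have "filterlim (\<lambda>n. 2 powr (?e j * real n) * Q n \<omega>) at_top sequentially"
        using elim by blast
      then show "filterlim (\<lambda>n. 2 powr (\<delta> * real n) * Q n \<omega>) at_top sequentially"
        by (rule filterlim_at_top_mono)
          (use j in \<open>intro always_eventually allI mult_right_mono nonneg powr_mono; auto\<close>)
    qed
  qed
qed

section \<open>The weighted quadratic variation over dyadic partitions\<close>

lemma AE_weighted_quadratic_variation:
  fixes H K T :: real
  assumes Z: "trifractional_Brownian_motion M H K Z" and "0 < T"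
  defines "\<gamma> \<equiv> min (2 * H * K) 1"
  shows "AE \<omega> in M. (\<forall>\<alpha><\<gamma>. (\<lambda>n. weighted_quadratic_variation Z T \<alpha> n \<omega>) \<longlonglongrightarrow> 0) \<and>
    (\<forall>\<alpha>>\<gamma>. filterlim (\<lambda>n. weighted_quadratic_variation Z T \<alpha> n \<omega>) at_top sequentially)"
proof -
  have HK: "0 < H" "H < 1" "0 < K" "K < 1" and "prob_space M"
    using Z by (auto simp: trifractional_Brownian_motion_def)
  interpret prob_space M by fact
  note incr = trifractional_Brownian_motion_increment[OF Z]
  define h where "h = 2 * H * K"
  have h: "0 < h" "\<gamma> \<le> h" "\<gamma> \<le> 1" using HK by (auto simp: h_def \<gamma>_def)
  \<comment> \<open>Normalizing at the critical weight reduces every \<alpha> to the factor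
    \<open>2 powr ((\<alpha> - \<gamma>) * n)\<close>.\<close>
  define Q where "Q n \<omega> = weighted_quadratic_variation Z T \<gamma> n \<omega>" for n \<omega>
  have wqv: "weighted_quadratic_variation Z T \<alpha> n \<omega> = 2 powr ((\<alpha> - \<gamma>) * real n) * Q n \<omega>" for \<alpha> n \<omega>
    by (simp add: Q_def weighted_quadratic_variation_def left_diff_distrib powr_diff)
  have Q_nonneg: "0 \<le> Q n \<omega>" for n \<omega>
    by (simp add: Q_def weighted_quadratic_variation_def sum_nonneg)
  define D where "D n k \<omega> = Z (real k * T / 2 ^ n) \<omega> - Z ((real k - 1) * T / 2 ^ n) \<omega>" for n k \<omega>
  have Q_eq: "Q n \<omega> = 2 powr (\<gamma> * real n) * (\<Sum>k = 1..2 ^ n. (D n k \<omega>)\<^sup>2)" for n \<omega>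
    by (simp add: Q_def weighted_quadratic_variation_def D_def)
  have D_int: "integrable M (\<lambda>\<omega>. (D n k \<omega>)\<^sup>2)"
    and D_le: "(LINT \<omega>|M. (D n k \<omega>)\<^sup>2) \<le> 16 * (T / 2 ^ n) powr h * real k powr (h - 2)"
    if "1 \<le> k" for n k
  proof -
    have *: "0 \<le> (real k - 1) * T / 2 ^ n" "0 \<le> real k * T / 2 ^ n"
        "(real k - 1) * T / 2 ^ n \<noteq> real k * T / 2 ^ n"
      using that \<open>0 < T\<close> by (auto simp: field_simps)
    show "integrable M (\<lambda>\<omega>. (D n k \<omega>)\<^sup>2)"
      using incr(3)[OF *] by (simp add: D_def)
    show "(LINT \<omega>|M. (D n k \<omega>)\<^sup>2) \<le> 16 * (T / 2 ^ n) powr h * real k powr (h - 2)"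
      using incr(4)[OF *] increment_variance_le[OF HK, of "T / 2 ^ n" k] that \<open>0 < T\<close>
      by (simp add: D_def h_def)
  qed
  have Q_int: "integrable M (Q n)" for n
    unfolding Q_eq[abs_def]
    by (intro integrable_mult_right Bochner_Integration.integrable_sum D_int) auto
  have zero: "AE \<omega> in M. (\<lambda>n. 2 powr (- \<delta> * real n) * Q n \<omega>) \<longlonglongrightarrow> 0" if "0 < \<delta>" for \<delta>
  proof (rule AE_tendsto_zero_if_summable_integral)
    \<comment> \<open>Spending \<open>\<delta> / 2\<close> on the sum leaves the total exponent
      \<open>- \<delta> + \<gamma> - h + (h - \<gamma> + \<delta> / 2) = - \<delta> / 2\<close> per
      \<open>n\<close>.\<close>
    obtain C where C: "0 \<le> C"
        "\<And>N. (\<Sum>k = 1..N. real k powr (h - 2)) \<le> C * real N powr (h - \<gamma> + \<delta> / 2)"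
      using sum_powr_le[of \<gamma> h "\<delta> / 2"] h \<open>0 < \<delta>\<close> by auto
    have le: "(LINT \<omega>|M. 2 powr (- \<delta> * real n) * Q n \<omega>) \<le> 16 * T powr h * C * 2 powr (- (\<delta> / 2) * real n)" for n
    proof -
      have "(LINT \<omega>|M. 2 powr (- \<delta> * real n) * Q n \<omega>) =
          2 powr (- \<delta> * real n) * (2 powr (\<gamma> * real n) * (\<Sum>k = 1..2 ^ n. LINT \<omega>|M. (D n k \<omega>)\<^sup>2))"
        using D_int by (simp add: Q_eq)
      also have "\<dots> \<le> 2 powr (- \<delta> * real n) * (2 powr (\<gamma> * real n) *
          (\<Sum>k = 1..2 ^ n. 16 * (T / 2 ^ n) powr h * real k powr (h - 2)))"
        by (intro mult_left_mono sum_mono D_le) auto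
      also have "\<dots> = 2 powr (- \<delta> * real n) * (2 powr (\<gamma> * real n) *
          (16 * (T / 2 ^ n) powr h * (\<Sum>k = 1..2 ^ n. real k powr (h - 2))))"
        by (simp add: sum_distrib_left)
      also have "\<dots> \<le> 2 powr (- \<delta> * real n) * (2 powr (\<gamma> * real n) *
          (16 * (T / 2 ^ n) powr h * (C * real (2 ^ n) powr (h - \<gamma> + \<delta> / 2))))"
        by (intro mult_left_mono C(2)) auto
      also have "real (2 ^ n) powr (h - \<gamma> + \<delta> / 2) = 2 powr (real n * (h - \<gamma> + \<delta> / 2))"
        by (simp add: powr_powr flip: powr_realpow)
      also have "(T / 2 ^ n) powr h = T powr h * 2 powr (- real n * h)"
        using \<open>0 < T\<close> by (simp add: powr_divide powr_powr powr_minus_divide flip: powr_realpow)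
      also have "2 powr (- \<delta> * real n) * (2 powr (\<gamma> * real n) * (16 * (T powr h * 2 powr (- real n * h)) *
            (C * 2 powr (real n * (h - \<gamma> + \<delta> / 2))))) =
          16 * T powr h * C * (2 powr (- \<delta> * real n) * 2 powr (\<gamma> * real n) *
            2 powr (- real n * h) * 2 powr (real n * (h - \<gamma> + \<delta> / 2)))"
        by (simp only: ac_simps)
      also have "2 powr (- \<delta> * real n) * 2 powr (\<gamma> * real n) *
            2 powr (- real n * h) * 2 powr (real n * (h - \<gamma> + \<delta> / 2)) = 2 powr (- (\<delta> / 2) * real n)"
        unfolding powr_add[symmetric] by (intro arg_cong[where f = "\<lambda>x. 2 powr x"]) (simp add: field_simps)
      finally show ?thesis .
    qed
    show "summable (\<lambda>n. LINT \<omega>|M. 2 powr (- \<delta> * real n) * Q n \<omega>)"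
    proof (rule summable_comparison_test')
      show "summable (\<lambda>n. 16 * T powr h * C * 2 powr (- (\<delta> / 2) * real n))"
        using \<open>0 < \<delta>\<close> by (intro summable_mult summable_two_powr_neg) auto
      show "norm (LINT \<omega>|M. 2 powr (- \<delta> * real n) * Q n \<omega>) \<le>
          16 * T powr h * C * 2 powr (- (\<delta> / 2) * real n)" if "n \<ge> 0" for n
        using le[of n] Q_nonneg by simp
    qed
  qed (use Q_int Q_nonneg in auto)
  have var_0: "increment_variance H K 0 t = (2 - 2 powr K) * t powr h" if "0 < t" for t
    using that by (simp add: increment_variance_def h_def powr_powr algebra_simps)
  have pos: "0 < (2 - 2 powr K) * T powr h"
    using HK \<open>0 < T\<close> powr_less_mono[of K 1 "2 :: real"] by simp
  \<comment> \<open>Both regimes use a scaled increment from time 0. The condition on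
    \<open>a n\<close> and \<open>t n\<close> fixes its variance at
    \<open>(2 - 2 powr K) * T powr h\<close> for all \<open>n\<close>.\<close>
  have "\<exists>a t. \<forall>n. 0 < t n \<and> (a n)\<^sup>2 * t n powr h = T powr h \<and> (\<forall>\<omega>. (a n * (Z (t n) \<omega> - Z 0 \<omega>))\<^sup>2 \<le> Q n \<omega>)"
  proof (cases "h < 1")
    case True
    then have \<gamma>: "\<gamma> = h" by (simp add: \<gamma>_def h_def)
    show ?thesis
    proof (intro exI allI conjI)
      fix n :: nat and \<omega>
      show "0 < T / 2 ^ n" using \<open>0 < T\<close> by simp
      have sq: "(2 powr (h * real n / 2) :: real)\<^sup>2 = 2 powr (h * real n)"
        by (simp add: power2_eq_square flip: powr_add)
      then show "(2 powr (h * real n / 2))\<^sup>2 * (T / 2 ^ n) powr h = T powr h"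
        using \<open>0 < T\<close> by (simp add: powr_divide powr_powr mult.commute flip: powr_realpow)
      \<comment> \<open>The first interval starts at 0; its term alone, with the square root of the
        weight as factor, carries the lower bound.\<close>
      have "(D n 1 \<omega>)\<^sup>2 \<le> (\<Sum>k = 1..2 ^ n. (D n k \<omega>)\<^sup>2)"
        by (rule member_le_sum) auto
      then show "(2 powr (h * real n / 2) * (Z (T / 2 ^ n) \<omega> - Z 0 \<omega>))\<^sup>2 \<le> Q n \<omega>"
        by (simp add: Q_eq \<gamma> power_mult_distrib sq D_def)
    qed
  next
    case False
    then have \<gamma>: "\<gamma> = 1" by (simp add: \<gamma>_def h_def)
    show ?thesis
    proof (intro exI allI conjI)
      fix n :: nat and \<omega>
      show "0 < T" by fact
      show "1\<^sup>2 * T powr h = T powr h" by simp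
      have "(\<Sum>k = 1..2 ^ n. D n k \<omega>) = Z T \<omega> - Z 0 \<omega>"
        using sum_telescope''[of 0 "2 ^ n" "\<lambda>k. Z (real k * T / 2 ^ n) \<omega>"]
        by (simp add: D_def of_nat_diff cong: sum.cong_simp)
      \<comment> \<open>Cauchy-Schwarz over \<open>2 ^ n\<close> terms costs the factor
        \<open>2 ^ n\<close>, which is exactly the weight at \<open>\<gamma> = 1\<close>.\<close>
      then show "(1 * (Z T \<omega> - Z 0 \<omega>))\<^sup>2 \<le> Q n \<omega>"
        using sum_squared_le_sum_of_squares[of "\<lambda>k. D n k \<omega>" "{1..2 ^ n}"]
        by (simp add: Q_eq \<gamma> powr_realpow mult.commute)
    qed
  qed
  then obtain a t where t: "\<And>n. 0 < t n" and a: "\<And>n. (a n)\<^sup>2 * t n powr h = T powr h"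
    and Q_ge: "\<And>n \<omega>. (a n * (Z (t n) \<omega> - Z 0 \<omega>))\<^sup>2 \<le> Q n \<omega>" by metis
  have t': "0 \<le> t n" "0 \<noteq> t n" for n using t[of n] by auto
  have top: "AE \<omega> in M. filterlim (\<lambda>n. 2 powr (\<delta> * real n) * Q n \<omega>) at_top sequentially" if "0 < \<delta>" for \<delta>
  proof (rule AE_filterlim_at_top_if_ge_gaussian_square[OF prob_space_axioms _ _ _ pos Q_ge \<open>0 < \<delta>\<close>])
    fix n
    show "gaussian_rv M (\<lambda>\<omega>. a n * (Z (t n) \<omega> - Z 0 \<omega>))"
      by (rule incr(1)) (use t' in auto)
    show "(LINT \<omega>|M. a n * (Z (t n) \<omega> - Z 0 \<omega>)) = 0"
      using incr(2)[of 0 "t n"] t' by simp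
    show "(LINT \<omega>|M. (a n * (Z (t n) \<omega> - Z 0 \<omega>))\<^sup>2) = (2 - 2 powr K) * T powr h"
      using incr(4)[of 0 "t n"] t' t by (simp add: power_mult_distrib var_0 a)
  qed
  have "AE \<omega> in M. (\<forall>\<delta>>0. (\<lambda>n. 2 powr (- \<delta> * real n) * Q n \<omega>) \<longlonglongrightarrow> 0) \<and>
      (\<forall>\<delta>>0. filterlim (\<lambda>n. 2 powr (\<delta> * real n) * Q n \<omega>) at_top sequentially)"
    by (rule AE_all_exponents) (fact Q_nonneg zero top)+
  then show ?thesis
  proof eventually_elim
    case (elim \<omega>)
    show ?case
    proof (intro conjI allI impI)
      \<comment> \<open>Here \<open>\<delta> = \<gamma> - \<alpha>\<close>;
        \<open>minus_diff_eq\<close> is disabled so that \<open>- \<delta>\<close> still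
        matches.\<close>
      fix \<alpha> assume "\<alpha> < \<gamma>"
      then have "(\<lambda>n. 2 powr (- (\<gamma> - \<alpha>) * real n) * Q n \<omega>) \<longlonglongrightarrow> 0"
        using elim by (simp del: minus_diff_eq)
      then show "(\<lambda>n. weighted_quadratic_variation Z T \<alpha> n \<omega>) \<longlonglongrightarrow> 0"
        by (simp add: wqv)
    next
      fix \<alpha> assume "\<gamma> < \<alpha>"
      then show "filterlim (\<lambda>n. weighted_quadratic_variation Z T \<alpha> n \<omega>) at_top sequentially"
        using elim by (simp add: wqv)
    qed
  qed
qed

theorem theorem2p1:
  fixes M :: "'a measure" and Z :: "real \<Rightarrow> 'a \<Rightarrow> real" and H K T :: real
  assumes "prob_space M"
    and "0 < H" "H < 1" and "0 < K" "K < 1" and "0 < T"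
    and "trifractional_Brownian_motion M H K Z"
  shows
    "(H * K < 1 / 2 \<longrightarrow>
        (AE \<omega> in M. \<forall>\<alpha><2 * H * K.
           (\<lambda>n. weighted_quadratic_variation Z T \<alpha> n \<omega>) \<longlonglongrightarrow> 0) \<and>
        (AE \<omega> in M. \<forall>\<alpha>>2 * H * K.
           filterlim (\<lambda>n. weighted_quadratic_variation Z T \<alpha> n \<omega>) at_top sequentially) \<and>
        critical_exponent M Z (2 * H * K)) \<and>
     (H * K \<ge> 1 / 2 \<longrightarrow>
        (AE \<omega> in M. \<forall>\<alpha><1.
           (\<lambda>n. weighted_quadratic_variation Z T \<alpha> n \<omega>) \<longlonglongrightarrow> 0) \<and>
        (AE \<omega> in M. \<forall>\<alpha>>1.
           filterlim (\<lambda>n. weighted_quadratic_variation Z T \<alpha> n \<omega>) at_top sequentially) \<and>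
        critical_exponent M Z 1)"
proof -
  note AE_T = AE_weighted_quadratic_variation[OF assms(7,6)]
  \<comment> \<open>The critical exponent refers to the unit interval, hence the second instance
    with \<open>T = 1\<close>.\<close>
  note AE_1 = AE_weighted_quadratic_variation[OF assms(7) zero_less_one]
  have "min (2 * H * K) 1 = 2 * H * K" if "H * K < 1 / 2"
    using that by simp
  moreover have "min (2 * H * K) 1 = 1" if "H * K \<ge> 1 / 2"
    using that by simp
  ultimately show ?thesis
    using AE_T AE_1 by (auto simp: critical_exponent_def)
qed

end
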